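(* For every integer $n\ge 2$, \[ \prod_{\substack{1\le k\le n \\ \gcd(k,n)=1}} \Gamma\left(\tfrac{k}{n}\right) = \frac{(2\pi)^{\phi(n)/2}}{\exp(\Lambda(n)/2)} = \begin{cases} (2\pi)^{\phi(n)/2}/\sqrt{p}, & \text{if } n=p^r \text{ for some prime } p \text{ and integer } r\ge 1, \\ (2\pi)^{\phi(n)/2}, & \text{otherwise.} \end{cases} \]
   Context: $\Gamma$ is Euler's Gamma function. $\phi(n)$ is Euler's function, the number of integers between $1$ and $n$ that are relatively prime to $n$. $\Lambda(n)$ is von Mangoldt's function: $\Lambda(n)=\log p$ if $n=p^r$ with $p$ prime and $r\ge 1$ an integer, and $\Lambda(n)=0$ otherwise. *)

theory Defs
  imports
    "HOL-Analysis.Analysis"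
    "HOL-Number_Theory.Number_Theory"
    "HOL-Number_Theory.Prime_Powers"
begin

end

theory Submission
  imports Defs
begin

text \<open>
  The reflection formula, together with the factorisation of \<open>1 + x + \<dots> + x ^ (n - 1)\<close> over the
  nontrivial \<open>n\<close>-th roots of unity evaluated at \<open>x = 1\<close>, shows that the product of
  \<open>\<Gamma>(k / n)\<close> over all \<open>0 < k \<le> n\<close> is \<open>(2 \<pi>) powr ((n - 1) / 2) / sqrt n\<close>.
  Grouping the fractions \<open>k / n\<close> by their reduced denominator turns the logarithm of this product
  into a sum over the divisors of \<open>n\<close>. Since \<open>n\<close> and \<open>ln n\<close> are the divisor sums of the totient
  and the von Mangoldt function, the claim follows because a function on the positive integers
  is determined by its divisor sums.
\<close>

text \<open>Off \<open>x = 1\<close> the geometric sum is \<open>(x ^ n - 1) / (x - 1)\<close>, so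
  its roots are the nontrivial roots of unity. Evaluating the factorisation at 1 turns the sum into
  \<open>n\<close>.\<close>

lemma prod_one_minus_roots_unity:
  assumes "n > 0"
  shows "(\<Prod>z\<in>{z. z ^ n = 1} - {1}. 1 - z) = (of_nat n :: complex)"
proof -
  define A where "A = {z :: complex. z ^ n = 1} - {1}"
  have fin: "finite A"
    using finite_roots_unity[of n] assms by (auto simp: A_def)
  have card: "card A = n - 1"
    using Complex.card_roots_unity_eq[OF assms] by (simp add: A_def card_Diff_singleton)
  define p where "p = (\<Prod>z\<in>A. [:-z, 1:])"
  define q where "q = (\<Sum>i<n. Polynomial.monom (1 :: complex) i)"
  have deg_p: "Polynomial.degree p = n - 1"
    unfolding p_def by (subst degree_prod_eq_sum_degree) (auto simp: card)
  have "lead_coeff p = 1"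
    by (simp add: p_def lead_coeff_prod)
  then have coeff_p: "Polynomial.coeff p (n - 1) = 1"
    by (simp add: deg_p)
  have coeff_q: "Polynomial.coeff q (n - 1) = 1"
    using assms by (simp add: q_def coeff_sum coeff_monom)
  have deg_q: "Polynomial.degree q \<le> n - 1"
    unfolding q_def by (intro degree_sum_le) (auto simp: degree_monom_eq)
  have poly_q: "poly q z = (\<Sum>i<n. z ^ i)" for z
    by (simp add: q_def poly_sum poly_monom)
  have "p = q"
  \<comment> \<open>The coefficients at \<open>n - 1\<close> agree, so the difference has degree
    below \<open>n - 1\<close> or is zero; it vanishes at the \<open>n - 1\<close> points of
    \<open>A\<close>, hence is zero.\<close>
  proof (rule poly_eqI_degree_lead_coeff)
    show "poly p z = poly q z" if "z \<in> A" for z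
    proof -
      have "poly p z = 0"
        using that fin by (auto simp: p_def poly_prod)
      moreover have "poly q z = 0"
        using that by (auto simp: poly_q A_def geometric_sum)
      ultimately show ?thesis by simp
    qed
  qed (use coeff_p coeff_q card deg_p deg_q in auto)
  then have "poly p 1 = poly q 1" by simp
  then show ?thesis
    by (simp add: poly_q p_def poly_prod A_def)
qed

text \<open>The chord from 1 to the root of unity with angle \<open>2 * pi * k / n\<close> has
  length \<open>2 * sin (pi * k / n)\<close>, so this is the absolute value of the product over the
  roots.\<close>

lemma prod_sin_pi_fractions:
  assumes "n > 0"
  shows "(\<Prod>k = 1..<n. sin (pi * real k / real n)) = n / 2 ^ (n - 1)"
proof -
  let ?f = "\<lambda>k. cis (2 * pi * real k / real n)"
  have "bij_betw ?f ({..<n} - {0}) ({z. z ^ n = 1} - {?f 0})"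
    using Complex.bij_betw_roots_unity[OF assms] assms
    by (intro bij_betw_DiffI) auto
  moreover have "{..<n} - {0} = {1..<n}" by auto
  ultimately have bij: "bij_betw ?f {1..<n} ({z. z ^ n = 1} - {1})" by simp
  have "real n = norm (\<Prod>z\<in>{z :: complex. z ^ n = 1} - {1}. 1 - z)"
    by (subst prod_one_minus_roots_unity) (use assms in auto)
  also have "\<dots> = (\<Prod>k = 1..<n. norm (1 - ?f k))"
    by (subst prod.reindex_bij_betw[OF bij, symmetric]) (rule prod_norm[symmetric])
  also have "\<dots> = (\<Prod>k = 1..<n. 2 * sin (pi * real k / real n))"
  proof (rule prod.cong[OF refl])
    fix k assume k: "k \<in> {1..<n}"
    have "norm (1 - ?f k) = 2 * \<bar>sin (pi * real k / real n)\<bar>"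
      using dist_exp_i_1[of "2 * pi * real k / real n"] by (simp add: cis_conv_exp norm_minus_commute)
    also have "sin (pi * real k / real n) \<ge> 0"
      using k by (intro sin_ge_zero) (auto simp: field_simps)
    then have "\<bar>sin (pi * real k / real n)\<bar> = sin (pi * real k / real n)" by simp
    finally show "norm (1 - ?f k) = 2 * sin (pi * real k / real n)" .
  qed
  also have "\<dots> = 2 ^ (n - 1) * (\<Prod>k = 1..<n. sin (pi * real k / real n))"
    by (simp add: prod.distrib)
  finally show ?thesis by (simp add: field_simps)
qed

lemma Gamma_reflection_real:
  fixes x :: real
  shows "Gamma x * Gamma (1 - x) = pi / sin (pi * x)"
proof -
  have "complex_of_real (Gamma x * Gamma (1 - x)) = of_real (pi / sin (pi * x))"
    using Gamma_reflection_complex[of "of_real x"]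
    by (simp flip: Gamma_complex_of_real sin_of_real)
  then show ?thesis by (simp only: of_real_eq_iff)
qed

text \<open>Pairing \<open>k\<close> with \<open>n - k\<close> doubles the sum, and the reflection
  formula reduces each pair to a sine, whose product over \<open>k\<close> is known.\<close>

lemma sum_ln_Gamma_fractions:
  assumes "n > 0"
  shows "(\<Sum>k = 1..n. ln (Gamma (real k / real n))) = (real n - 1) / 2 * ln (2 * pi) - ln n / 2"
proof -
  let ?S = "\<Sum>k = 1..<n. ln (Gamma (real k / real n))"
  have sin_pos: "sin (pi * real k / real n) > 0" if "k \<in> {1..<n}" for k
    using that by (intro sin_gt_zero) (auto simp: field_simps)
  have reflect: "?S = (\<Sum>k = 1..<n. ln (Gamma (1 - real k / real n)))"
    using assms
    by (intro sum.reindex_bij_witness[of _ "\<lambda>k. n - k" "\<lambda>k. n - k"])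
       (auto simp: of_nat_diff diff_divide_distrib)
  have "?S + ?S = (\<Sum>k = 1..<n. ln (Gamma (real k / real n)) + ln (Gamma (1 - real k / real n)))"
    by (subst (2) reflect) (simp add: sum.distrib)
  also have "\<dots> = (\<Sum>k = 1..<n. ln pi - ln (sin (pi * real k / real n)))"
  proof (rule sum.cong[OF refl])
    fix k assume k: "k \<in> {1..<n}"
    have "ln (Gamma (real k / real n)) + ln (Gamma (1 - real k / real n)) =
        ln (Gamma (real k / real n) * Gamma (1 - real k / real n))"
      using k by (intro ln_mult_pos[symmetric] Gamma_real_pos) auto
    also have "\<dots> = ln (pi / sin (pi * real k / real n))"
      by (simp add: Gamma_reflection_real)
    also have "\<dots> = ln pi - ln (sin (pi * real k / real n))"
      using sin_pos[OF k] by (intro ln_divide_pos) auto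
    finally show "ln (Gamma (real k / real n)) + ln (Gamma (1 - real k / real n)) =
        ln pi - ln (sin (pi * real k / real n))" .
  qed
  also have "\<dots> = (real n - 1) * ln pi - (\<Sum>k = 1..<n. ln (sin (pi * real k / real n)))"
    using assms by (simp add: sum_subtractf of_nat_diff)
  also have "(\<Sum>k = 1..<n. ln (sin (pi * real k / real n))) = ln (\<Prod>k = 1..<n. sin (pi * real k / real n))"
    by (intro ln_prod[symmetric]) (use sin_pos in fastforce)+
  also have "\<dots> = ln n - (real n - 1) * ln 2"
    using assms unfolding prod_sin_pi_fractions[OF assms]
    by (simp add: ln_div ln_realpow of_nat_diff)
  finally have "?S = (real n - 1) / 2 * ln (2 * pi) - ln n / 2"
    by (simp add: ln_mult field_simps)
  \<comment> \<open>The term \<open>k = n\<close> is \<open>ln (Gamma 1) = 0\<close>. Including it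
    gives the range that the grouping by reduced denominators needs.\<close>
  moreover have "{1..n} = insert n {1..<n}" using assms by auto
  ultimately show ?thesis using assms by simp
qed

text \<open>Cancelling \<open>d = gcd k n\<close> makes \<open>k / n\<close> a reduced fraction with
  denominator \<open>n div d\<close>; as \<open>d\<close> runs over the divisors of
  \<open>n\<close>, so does \<open>n div d\<close>.\<close>

lemma sum_divisors_totatives:
  fixes f :: "real \<Rightarrow> 'a :: comm_monoid_add"
  assumes "n > 0"
  shows "(\<Sum>d | d dvd n. \<Sum>k\<in>totatives d. f (real k / real d)) = (\<Sum>k = 1..n. f (real k / real n))"
proof -
  define A where "A = (\<lambda>d. {k\<in>{0<..n}. gcd k n = d})"
  have inner: "(\<Sum>k\<in>A d. f (real k / real n)) =
      (\<Sum>k\<in>totatives (n div d). f (real k / real (n div d)))" if d: "d dvd n" for d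
  proof -
    have "d > 0" using d assms by (auto intro!: Nat.gr0I)
    have "(\<Sum>k\<in>A d. f (real k / real n)) =
        (\<Sum>k\<in>totatives (n div d). f (real (k * d) / real n))"
      unfolding A_def
      by (rule sum.reindex_bij_betw[OF bij_betw_totatives_gcd_eq[OF d assms], symmetric])
    also have "\<dots> = (\<Sum>k\<in>totatives (n div d). f (real k / real (n div d)))"
      using \<open>d > 0\<close> d by (intro sum.cong) (auto simp: real_of_nat_div)
    finally show ?thesis .
  qed
  have "{1..n} = (\<Union>d\<in>{d. d dvd n}. A d)" by (auto simp: A_def)
  then have "(\<Sum>k = 1..n. f (real k / real n)) = (\<Sum>d | d dvd n. \<Sum>k\<in>A d. f (real k / real n))"
    using assms by (simp only:, intro sum.UNION_disjoint) (auto simp: A_def)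
  also have "\<dots> = (\<Sum>d | d dvd n. \<Sum>k\<in>totatives (n div d). f (real k / real (n div d)))"
    by (intro sum.cong refl inner) auto
  also have "\<dots> = (\<Sum>d | d dvd n. \<Sum>k\<in>totatives d. f (real k / real d))"
    by (rule sum.reindex_bij_witness[of _ "(div) n" "(div) n"]) (use assms in \<open>auto elim: dvdE\<close>)
  finally show ?thesis ..
qed

text \<open>The uniqueness half of Moebius inversion: by strong induction the terms at proper
  divisors agree and cancel, leaving those at \<open>n\<close>.\<close>

lemma divisor_sums_determine:
  fixes f g :: "nat \<Rightarrow> 'a :: cancel_comm_monoid_add"
  assumes "\<And>n. n > 0 \<Longrightarrow> (\<Sum>d | d dvd n. f d) = (\<Sum>d | d dvd n. g d)" and "n > 0"
  shows "f n = g n"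
  using \<open>n > 0\<close>
proof (induction n rule: less_induct)
  case (less n)
  have split: "(\<Sum>d | d dvd n. h d) = h n + (\<Sum>d | d dvd n \<and> d \<noteq> n. h d)"
    for h :: "nat \<Rightarrow> 'a"
    using less.prems by (subst sum.remove[of _ n]) (auto intro!: arg_cong2[where f = "(+)"] sum.cong)
  have "(\<Sum>d | d dvd n \<and> d \<noteq> n. f d) = (\<Sum>d | d dvd n \<and> d \<noteq> n. g d)"
  proof (rule sum.cong[OF refl])
    fix d assume "d \<in> {d. d dvd n \<and> d \<noteq> n}"
    then show "f d = g d"
      using less.prems dvd_imp_le[of d n] by (intro less.IH) (auto intro!: Nat.gr0I)
  qed
  then show ?case
    using assms(1)[OF less.prems] by (simp add: split)
qed

lemma sum_ln_Gamma_totatives: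
  assumes "n \<ge> 2"
  shows "(\<Sum>k\<in>totatives n. ln (Gamma (real k / real n))) =
    totient n / 2 * ln (2 * pi) - mangoldt n / 2"
proof -
  \<comment> \<open>The totients sum to \<open>m\<close>, but the Gamma sum carries the factor
    \<open>m - 1\<close>. The correction at \<open>d = 1\<close> removes the excess
    \<open>ln (2 * pi) / 2\<close>, making \<open>g 1 = 0 = ln (Gamma 1)\<close>; for
    \<open>n \<ge> 2\<close> it vanishes.\<close>
  define g where
    "g d = totient d / 2 * ln (2 * pi) - mangoldt d / 2 - (if d = 1 then ln (2 * pi) / 2 else 0)"
    for d
  have "(\<Sum>k\<in>totatives n. ln (Gamma (real k / real n))) = g n"
  proof (rule divisor_sums_determine[of "\<lambda>d. \<Sum>k\<in>totatives d. ln (Gamma (real k / real d))"])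
    fix m :: nat assume m: "m > 0"
    have "(\<Sum>d | d dvd m. g d) =
        real (\<Sum>d | d dvd m. totient d) / 2 * ln (2 * pi) - (\<Sum>d | d dvd m. mangoldt d) / 2
        - ln (2 * pi) / 2"
      using m by (simp add: g_def sum_subtractf sum_divide_distrib sum_distrib_right sum.delta)
    also have "\<dots> = (real m - 1) / 2 * ln (2 * pi) - ln m / 2"
      using m by (simp add: totient_divisor_sum mangoldt_sum field_simps)
    finally show "(\<Sum>d | d dvd m. \<Sum>k\<in>totatives d. ln (Gamma (real k / real d))) =
        (\<Sum>d | d dvd m. g d)"
      using sum_divisors_totatives[OF m, of "\<lambda>x. ln (Gamma x)"] sum_ln_Gamma_fractions[OF m]
      by simp
  qed (use assms in auto)
  then show ?thesis using assms by (simp add: g_def)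
qed

theorem theorem1:
  fixes n :: nat
  assumes "n \<ge> 2"
  shows "(\<Prod>k | 1 \<le> k \<and> k \<le> n \<and> gcd k n = 1. Gamma (real k / real n)) =
           (2 * pi) powr (real (totient n) / 2) / exp (mangoldt n / 2)
       \<and> (\<forall>p r. prime p \<and> 1 \<le> r \<and> n = p ^ r \<longrightarrow>
           (2 * pi) powr (real (totient n) / 2) / exp (mangoldt n / 2) =
           (2 * pi) powr (real (totient n) / 2) / sqrt (real p))
       \<and> (\<not> (\<exists>p r. prime p \<and> 1 \<le> r \<and> n = p ^ r) \<longrightarrow>
           (2 * pi) powr (real (totient n) / 2) / exp (mangoldt n / 2) =
           (2 * pi) powr (real (totient n) / 2))"
proof (intro conjI allI impI)
  have "{k. 1 \<le> k \<and> k \<le> n \<and> gcd k n = 1} = totatives n"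
    by (auto simp: totatives_def coprime_imp_gcd_eq_1 intro: iffD2[OF coprime_iff_gcd_eq_1])
  \<comment> \<open>Totatives are positive, so every Gamma value is positive and equals the
    exponential of its logarithm.\<close>
  moreover have "(\<Prod>k\<in>totatives n. Gamma (real k / real n)) =
      exp (\<Sum>k\<in>totatives n. ln (Gamma (real k / real n)))"
    using assms by (auto simp: exp_sum in_totatives_iff Gamma_real_pos intro!: prod.cong)
  ultimately show "(\<Prod>k | 1 \<le> k \<and> k \<le> n \<and> gcd k n = 1. Gamma (real k / real n)) =
      (2 * pi) powr (real (totient n) / 2) / exp (mangoldt n / 2)"
    using assms by (simp add: sum_ln_Gamma_totatives exp_diff powr_def)
next
  fix p r assume "prime p \<and> 1 \<le> r \<and> n = p ^ r"
  \<comment> \<open>At a prime power \<open>mangoldt\<close> is \<open>ln p\<close> whatever the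
    exponent \<open>r\<close>, and half of it is the logarithm of the square root.\<close>
  then have "exp (mangoldt n / 2) = exp (ln (sqrt (real p)))"
    using prime_gt_0_nat[of p] by (simp add: ln_sqrt)
  also have "\<dots> = sqrt (real p)"
    using \<open>prime p \<and> 1 \<le> r \<and> n = p ^ r\<close> prime_gt_0_nat[of p] by (intro exp_ln) auto
  finally show "(2 * pi) powr (real (totient n) / 2) / exp (mangoldt n / 2) =
      (2 * pi) powr (real (totient n) / 2) / sqrt (real p)" by simp
next
  assume "\<not> (\<exists>p r. prime p \<and> 1 \<le> r \<and> n = p ^ r)"
  then have "\<not> primepow n" by (auto simp: primepow_def Suc_le_eq)
  then show "(2 * pi) powr (real (totient n) / 2) / exp (mangoldt n / 2) =
      (2 * pi) powr (real (totient n) / 2)" by (simp add: mangoldt_def)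
qed

end
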